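(* Let $n \in \mathbb{N}$ and $x \in \mathbb{R}$ with $x \geq 1$. Then $$P_n(x) < P_{n+1}(x) \quad\text{and}\quad 1 \leq P_n'(x) < P_{n+1}'(x),$$ where $P_n'$ denotes the derivative of $P_n$ with respect to $x$.
   Context: $\mathbb{N} = \{1,2,3,\ldots\}$. For $n \in \mathbb{N}$ let $\sigma(n) := \sum_{d \mid n} d$ be the sum of the positive divisors of $n$. The polynomials $P_n(x)$ are defined recursively by $P_0(x) := 1$ and, for $n \geq 1$, $P_n(x) := \frac{x}{n} \sum_{k=1}^{n} \sigma(k)\, P_{n-k}(x)$. Equivalently, $\sum_{n=0}^{\infty} P_n(z)\, q^n = \prod_{n=1}^{\infty} (1-q^n)^{-z}$ for $z \in \mathbb{C}$; in particular, for $k \in \mathbb{N}$, $P_n(k)$ is the number of $k$-colored partitions of $n$. *)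

theory Defs
  imports Complex_Main "HOL-Computational_Algebra.Polynomial"
begin

definition sigma :: "nat \<Rightarrow> nat" where
  "sigma n = (\<Sum>d | d dvd n. d)"

fun P :: "nat \<Rightarrow> real poly" where
  "P 0 = 1"
| "P (Suc m) =
     [:0, 1 / real (Suc m):] * (\<Sum>k = 1..Suc m. smult (real (sigma k)) (P (Suc m - k)))"

lemma poly_P_rec:
  assumes "n \<ge> 1"
  shows "poly (P n) x = x / real n * (\<Sum>k = 1..n. real (sigma k) * poly (P (n - k)) x)"
proof -
  from assms obtain m where "n = Suc m"
    by (cases n) auto
  then show ?thesis
    by (simp only: P.simps poly_mult poly_sum poly_smult) simp
qed

end

theory Submission
  imports Defs
begin

text \<open>
  Write \<open>F(q) = (\<Sum>n. P\<^sub>n(x) q^n) = (\<Prod>n\<ge>1. (1 - q^n) powr (-x))\<close>, so that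
  \<open>ln F = x (\<Sum>k\<ge>1. \<sigma>(k)/k q^k)\<close>. Both halves of the theorem come from differentiating
  power series of this exponential form, once in \<open>q\<close> and once in \<open>x\<close>.

  In \<open>q\<close>: the differences \<open>P\<^sub>n - P\<^sub>n\<^sub>-\<^sub>1\<close> are the coefficients of
  \<open>(1 - q) F = exp (\<Sum>k\<ge>1. (x \<sigma>(k) - 1)/k q^k)\<close>. For \<open>x \<ge> 1\<close> the exponent has
  nonnegative coefficients, which are positive from \<open>k = 2\<close> on because \<open>\<sigma>(k) > 1\<close> there;
  hence so are the differences. The recursion expressing this is
  \<open>P_diff_recurrence\<close>.

  In \<open>x\<close>: the derivative of \<open>F\<close> is \<open>F \<cdot> (\<Sum>k\<ge>1. \<sigma>(k)/k q^k)\<close>, that is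
  \<open>P\<^sub>n' = (\<Sum>k=1..n. \<sigma>(k)/k P\<^sub>n\<^sub>-\<^sub>k)\<close> (\<open>pderiv_P_convolution\<close>). So \<open>P\<^sub>n\<^sub>+\<^sub>1' - P\<^sub>n'\<close> is a
  combination, with positive weights, of the differences of the \<open>P\<^sub>m\<close>, which are already known
  to be nonnegative, plus the positive term \<open>\<sigma>(n+1)/(n+1)\<close>.

  Both identities are proved from the recursion for \<open>P\<^sub>n\<close> by rearranging finite sums.
\<close>

lemma sigma_pos:
  assumes "n \<ge> 1"
  shows "sigma n \<ge> 1"
proof -
  have "(\<Sum>d\<in>{1}. d) \<le> sigma n"
    unfolding sigma_def using assms by (intro sum_mono2) auto
  then show ?thesis by simp
qed

lemma sigma_gt_1:
  assumes "n \<ge> 2"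
  shows "sigma n > 1"
proof -
  have "(\<Sum>d\<in>{1, n}. d) \<le> sigma n"
    unfolding sigma_def using assms by (intro sum_mono2) auto
  then show ?thesis using assms by simp
qed

lemma poly_P_rec_mult:
  "real n * poly (P n) x = x * (\<Sum>k = 1..n. real (sigma k) * poly (P (n - k)) x)"
proof (cases "n = 0")
  case False
  then show ?thesis by (subst poly_P_rec) auto
qed simp

text \<open>
  The value at \<open>0\<close> is \<open>P\<^sub>0 = 1\<close>, the constant coefficient of \<open>(1 - q) F\<close>.
\<close>
definition P_diff :: "real \<Rightarrow> nat \<Rightarrow> real" where
  "P_diff x n = (if n = 0 then 1 else poly (P n) x - poly (P (n - 1)) x)"

lemma sum_P_diff: "(\<Sum>k\<le>n. P_diff x k) = poly (P n) x"
  by (induction n) (auto simp: P_diff_def)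

lemma sum_mult_P_diff:
  "(\<Sum>k = 1..Suc m. c k * P_diff x (Suc m - k)) =
   (\<Sum>k = 1..Suc m. c k * poly (P (Suc m - k)) x) - (\<Sum>k = 1..m. c k * poly (P (m - k)) x)"
proof -
  have "(\<Sum>k = 1..m. c k * P_diff x (Suc m - k)) =
        (\<Sum>k = 1..m. c k * poly (P (Suc m - k)) x - c k * poly (P (m - k)) x)"
    by (intro sum.cong) (auto simp: P_diff_def right_diff_distrib Suc_diff_le)
  then show ?thesis
    by (simp add: sum_subtractf P_diff_def)
qed

text \<open>
  This is \<open>q G' = G \<cdot> (\<Sum>k\<ge>1. (x \<sigma>(k) - 1) q^k)\<close> for \<open>G = (1 - q) F\<close>, read off at \<open>q^n\<close>:
  passing from \<open>F\<close> to \<open>G\<close> adds \<open>ln (1 - q)\<close> to the logarithm, which lowers every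
  coefficient of the logarithmic derivative by \<open>1\<close>.
\<close>
lemma P_diff_recurrence:
  "real n * P_diff x n = (\<Sum>k = 1..n. (x * real (sigma k) - 1) * P_diff x (n - k))"
proof (cases n)
  case (Suc m)
  have tele: "(\<Sum>k = 1..Suc m. P_diff x (Suc m - k)) = poly (P m) x"
    unfolding sum_P_diff [symmetric]
    by (rule sum.reindex_bij_witness [where i = "\<lambda>k. Suc m - k" and j = "\<lambda>k. Suc m - k"]) auto
  have "real n * P_diff x n =
        real (Suc m) * poly (P (Suc m)) x - real m * poly (P m) x - poly (P m) x"
    by (simp add: Suc P_diff_def algebra_simps)
  also have "\<dots> = x * (\<Sum>k = 1..Suc m. real (sigma k) * P_diff x (Suc m - k)) - poly (P m) x"
    unfolding poly_P_rec_mult sum_mult_P_diff by (simp add: right_diff_distrib)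
  also have "\<dots> = (\<Sum>k = 1..n. (x * real (sigma k) - 1) * P_diff x (n - k))"
    unfolding Suc tele [symmetric] sum_distrib_left sum_subtractf [symmetric]
    by (intro sum.cong) (auto simp: algebra_simps)
  finally show ?thesis .
qed simp

lemma P_diff_weight_nonneg:
  assumes "x \<ge> 1" and "k \<ge> 1"
  shows "x * real (sigma k) - 1 \<ge> 0"
  using mult_mono [of 1 x 1 "real (sigma k)"] sigma_pos [OF assms(2)] assms(1) by simp

lemma P_diff_nonneg:
  assumes "x \<ge> 1"
  shows "P_diff x n \<ge> 0"
proof (induction n rule: less_induct)
  case (less n)
  show ?case
  proof (cases "n = 0")
    case False
    have "real n * P_diff x n \<ge> 0"
      unfolding P_diff_recurrence using P_diff_weight_nonneg [OF assms] less.IH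
      by (intro sum_nonneg mult_nonneg_nonneg) auto
    then show ?thesis using False by (simp add: zero_le_mult_iff)
  qed (simp add: P_diff_def)
qed

text \<open>
  The bound \<open>n \<ge> 2\<close> is sharp: \<open>P\<^sub>1 - P\<^sub>0 = x - 1\<close> vanishes at \<open>x = 1\<close>.
\<close>
lemma P_diff_pos:
  assumes "x \<ge> 1" and "n \<ge> 2"
  shows "P_diff x n > 0"
proof -
  \<comment> \<open>The summand \<open>k = n\<close> is positive, since it carries the constant coefficient \<open>1\<close>.\<close>
  have "0 < (x * real (sigma n) - 1) * P_diff x (n - n)"
  proof -
    have "1 < real (sigma n)" using sigma_gt_1 [OF assms(2)] by simp
    also have "\<dots> \<le> x * real (sigma n)" using assms(1) by (simp add: mult_le_cancel_right1)
    finally show ?thesis by (simp add: P_diff_def)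
  qed
  also have "\<dots> \<le> (\<Sum>k = 1..n. (x * real (sigma k) - 1) * P_diff x (n - k))"
    using P_diff_weight_nonneg [OF assms(1)] P_diff_nonneg [OF assms(1)] assms(2)
    by (intro member_le_sum mult_nonneg_nonneg) auto
  also have "\<dots> = real n * P_diff x n"
    by (rule P_diff_recurrence [symmetric])
  finally show ?thesis by (simp add: zero_less_mult_iff)
qed

lemma sum_triangle_swap:
  fixes f :: "nat \<Rightarrow> nat \<Rightarrow> 'a :: comm_monoid_add"
  shows "(\<Sum>k = 1..n. \<Sum>j = 1..n - k. f k j) = (\<Sum>j = 1..n. \<Sum>k = 1..n - j. f k j)"
  unfolding sum.Sigma [OF finite_atLeastAtMost ballI [OF finite_atLeastAtMost]]
  by (rule sum.reindex_bij_witness [where i = "\<lambda>(j, k). (k, j)" and j = "\<lambda>(k, j). (j, k)"]) auto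

lemma poly_pderiv_P_rec:
  "real n * poly (pderiv (P n)) x =
     (\<Sum>k = 1..n. real (sigma k) * poly (P (n - k)) x) +
     x * (\<Sum>k = 1..n. real (sigma k) * poly (pderiv (P (n - k))) x)"
proof -
  have "smult (real n) (P n) = [:0, 1:] * (\<Sum>k = 1..n. smult (real (sigma k)) (P (n - k)))"
    by (intro iffD1 [OF poly_eq_poly_eq_iff] ext)
      (simp only: poly_smult poly_P_rec_mult poly_mult poly_sum, simp)
  then have "smult (real n) (pderiv (P n)) =
      pderiv ([:0, 1:] * (\<Sum>k = 1..n. smult (real (sigma k)) (P (n - k))))"
    by (metis pderiv_smult)
  also have "\<dots> = (\<Sum>k = 1..n. smult (real (sigma k)) (P (n - k))) +
      [:0, 1:] * (\<Sum>k = 1..n. smult (real (sigma k)) (pderiv (P (n - k))))"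
    by (simp only: pderiv_mult higher_pderiv_sum [of 1, simplified] pderiv_smult) (simp add: pderiv_pCons)
  finally have "poly (smult (real n) (pderiv (P n))) x = poly \<dots> x"
    by simp
  then show ?thesis by (simp add: poly_sum)
qed

text \<open>
  By induction, \<open>x (\<Sum>k. \<sigma>(k) P\<^sub>n\<^sub>-\<^sub>k')\<close> becomes a double sum over \<open>k + j \<le> n\<close>; summing over \<open>k\<close>
  first, the recursion for \<open>P\<^sub>n\<^sub>-\<^sub>j\<close> turns it into \<open>(\<Sum>j. \<sigma>(j)/j (n - j) P\<^sub>n\<^sub>-\<^sub>j)\<close>. The missing
  \<open>\<sigma>(j)/j \<cdot> j P\<^sub>n\<^sub>-\<^sub>j\<close> is the other term produced by the product rule.
\<close>
lemma pderiv_P_convolution: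
  "poly (pderiv (P n)) x = (\<Sum>j = 1..n. real (sigma j) / real j * poly (P (n - j)) x)"
proof (induction n rule: less_induct)
  case (less n)
  show ?case
  proof (cases "n = 0")
    case False
    have "x * (\<Sum>k = 1..n. real (sigma k) * poly (pderiv (P (n - k))) x) =
        x * (\<Sum>k = 1..n. \<Sum>j = 1..n - k.
          real (sigma k) * (real (sigma j) / real j * poly (P (n - k - j)) x))"
      using less.IH by (simp add: sum_distrib_left)
    also have "\<dots> = x * (\<Sum>j = 1..n. \<Sum>k = 1..n - j.
          real (sigma k) * (real (sigma j) / real j * poly (P (n - k - j)) x))"
      by (subst sum_triangle_swap) simp
    also have "\<dots> = (\<Sum>j = 1..n. real (sigma j) / real j *
          (x * (\<Sum>k = 1..n - j. real (sigma k) * poly (P (n - j - k)) x)))"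
      by (simp add: sum_distrib_left mult_ac add.commute)
    also have "\<dots> = (\<Sum>j = 1..n. real (sigma j) / real j * (real (n - j) * poly (P (n - j)) x))"
      by (simp only: poly_P_rec_mult)
    finally have "real n * poly (pderiv (P n)) x =
        (\<Sum>j = 1..n. real (sigma j) * poly (P (n - j)) x +
                    real (sigma j) / real j * (real (n - j) * poly (P (n - j)) x))"
      unfolding poly_pderiv_P_rec by (simp add: sum.distrib)
    also have "\<dots> = (\<Sum>j = 1..n. real n * (real (sigma j) / real j * poly (P (n - j)) x))"
      by (intro sum.cong) (auto simp: of_nat_diff field_simps)
    also have "\<dots> = real n * (\<Sum>j = 1..n. real (sigma j) / real j * poly (P (n - j)) x)"
      by (simp only: sum_distrib_left)
    finally show ?thesis using False by simp
  qed simp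
qed

lemma pderiv_P_less_Suc:
  assumes "x \<ge> 1"
  shows "poly (pderiv (P n)) x < poly (pderiv (P (Suc n))) x"
proof -
  have "0 < real (sigma (Suc n)) / real (Suc n) * P_diff x (Suc n - Suc n)"
    using sigma_pos [of "Suc n"] by (simp add: P_diff_def)
  also have "\<dots> \<le> (\<Sum>k = 1..Suc n. real (sigma k) / real k * P_diff x (Suc n - k))"
    using P_diff_nonneg [OF assms] by (intro member_le_sum) auto
  also have "\<dots> = poly (pderiv (P (Suc n))) x - poly (pderiv (P n)) x"
    unfolding pderiv_P_convolution by (rule sum_mult_P_diff)
  finally show ?thesis by simp
qed

lemma pderiv_P_ge_1:
  assumes "n \<ge> 1" and "x \<ge> 1"
  shows "poly (pderiv (P n)) x \<ge> 1"
  using assms(1)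
proof (induction n rule: dec_induct)
  case base
  have "sigma 1 = 1" by (simp add: sigma_def)
  then show ?case by (simp add: pderiv_P_convolution del: P.simps(2))
next
  case (step n)
  then show ?case using pderiv_P_less_Suc [OF assms(2), of n] by simp
qed

theorem theorem1p3:
  fixes n :: nat and x :: real
  assumes "n \<ge> 1" and "x \<ge> 1"
  shows "poly (P n) x < poly (P (n + 1)) x \<and>
         1 \<le> poly (pderiv (P n)) x \<and>
         poly (pderiv (P n)) x < poly (pderiv (P (n + 1))) x"
  using P_diff_pos [of x "n + 1"] pderiv_P_ge_1 [of n x] pderiv_P_less_Suc [of x n] assms
  by (simp add: P_diff_def del: P.simps)

end
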